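(* Let $q>1$, let $\mathbf{c},\mathbf{v}_0\in\mathbb{R}^d$ with $\mathbf{c}>0$ and $\mathbf{v}_0>0$ (componentwise), and let $f(\mathbf{x}):=(\mathbf{c}^{\top}\mathbf{x})^q$. For $u>0$ let $Q_u:=\mathbf{v}_0+u[0,1]^d$ and $F:=\max_{\mathbf{x}\in Q_u}f(\mathbf{x})=f(\mathbf{v}_0+u\mathbf{1})=(u\mathbf{c}^{\top}\mathbf{1}+\mathbf{c}^{\top}\mathbf{v}_0)^q$. Then $$\lim_{u\to\infty}\frac{\Delta(P^0,P)}{\operatorname{vol}(P^0(f,Q_u,F))}\ \ge\ \frac{(q-1)\,\dfrac{\Gamma(q+1)\,d!}{\Gamma(q+d+1)}\,\dfrac{\sum_{j=1}^{d}j^q}{d^q}}{(q+d+1)-(d+2)\,\dfrac{\Gamma(q+1)\,d!}{\Gamma(q+d+1)}\,\dfrac{\sum_{j=1}^{d}j^q}{d^q}}.$$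
   Context: $\mathbf{1}$ is the all-ones vector and $\Gamma$ is the Gamma function. For a concave upper bound $\mu$ of $f$ on a polytope $Q\subset\mathbb{R}^d_{\ge0}\setminus\{\mathbf{0}\}$ (a concave function $\mu:Q\to\mathbb{R}$ with $\mu\ge f$ on $Q$), put $\tilde f(\mathbf{x},z):=zf(\mathbf{x}/z)$ and $\tilde\mu(\mathbf{x},z):=z\mu(\mathbf{x}/z)$ for $z>0$, $\mathbf{x}\in z\cdot Q$, and (closure convention) $\tilde\mu(\mathbf{0},0):=0$. The perspective relaxation is $$P(f,Q):=\operatorname{convcl}\{(\mathbf{x},y,z)\in\mathbb{R}^d\times\mathbb{R}\times\mathbb{R}:\ \tilde\mu(\mathbf{x},z)\ge y\ge\tilde f(\mathbf{x},z),\ \mathbf{x}\in z\cdot Q,\ 1\ge z>0\}$$ ($\operatorname{convcl}$ is the closure of the convex hull), and the naïve relaxation is $$P^0(f,Q)=P^0(f,Q,\mu):=\{(\mathbf{x},y,z)\in\mathbb{R}^d\times\mathbb{R}\times\mathbb{R}:\ \tilde\mu(\mathbf{x},z)\ge y\ge f(\mathbf{x}),\ \mathbf{x}\in z\cdot Q,\ 1\ge z\ge 0\}.$$ $\operatorname{vol}$ denotes Lebesgue measure in $\mathbb{R}^{d+2}$. $\Delta(P^0,P):=\operatorname{vol}(P^0(f,Q_u))-\operatorname{vol}(P(f,Q_u))$, with both relaxations defined using the constant upper bound $\mu\equiv F$. *)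

theory Defs
  imports "HOL-Analysis.Analysis"
begin

text \<open>
  The perspective \<open>(x, z) \<mapsto> z g(x/z)\<close> of a function \<open>g\<close>, with the closure convention that the
  value is \<open>0\<close> at \<open>z = 0\<close>. It is only ever used for \<open>x \<in> z \<cdot> Q\<close>, where \<open>z = 0\<close> forces \<open>x = 0\<close>.
\<close>
definition perspective :: "('a::real_vector \<Rightarrow> real) \<Rightarrow> 'a \<Rightarrow> real \<Rightarrow> real" where
  "perspective g x z = (if z = 0 then 0 else z * g (x /\<^sub>R z))"

text \<open>
  In both relaxations \<open>\<mu>\<close> is meant to be a concave upper bound of \<open>f\<close> on \<open>Q\<close>.
\<close>
definition perspective_relaxation ::
  "('a::euclidean_space \<Rightarrow> real) \<Rightarrow> 'a set \<Rightarrow> ('a \<Rightarrow> real) \<Rightarrow> ('a \<times> real \<times> real) set" where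
  "perspective_relaxation f Q \<mu> =
     closure (convex hull
       {(x, y, z). perspective \<mu> x z \<ge> y \<and> y \<ge> perspective f x z \<and>
                   x \<in> (\<lambda>w. z *\<^sub>R w) ` Q \<and> 1 \<ge> z \<and> z > 0})"

definition naive_relaxation ::
  "('a::euclidean_space \<Rightarrow> real) \<Rightarrow> 'a set \<Rightarrow> ('a \<Rightarrow> real) \<Rightarrow> ('a \<times> real \<times> real) set" where
  "naive_relaxation f Q \<mu> =
     {(x, y, z). perspective \<mu> x z \<ge> y \<and> y \<ge> f x \<and>
                 x \<in> (\<lambda>w. z *\<^sub>R w) ` Q \<and> 1 \<ge> z \<and> z \<ge> 0}"

abbreviation vol :: "('a::euclidean_space) set \<Rightarrow> real" where
  "vol S \<equiv> measure lebesgue S"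

definition relaxation_gap ::
  "('a::euclidean_space \<Rightarrow> real) \<Rightarrow> 'a set \<Rightarrow> ('a \<Rightarrow> real) \<Rightarrow> real" where
  "relaxation_gap f Q \<mu> = vol (naive_relaxation f Q \<mu>) - vol (perspective_relaxation f Q \<mu>)"

text \<open>
  Used only where \<open>c \<bullet> x \<ge> 0\<close>, so \<open>powr\<close> is the usual real power (and \<open>0 powr q = 0\<close>).
\<close>
definition lin_power :: "real ^ 'n \<Rightarrow> real \<Rightarrow> real ^ 'n \<Rightarrow> real" where
  "lin_power c q x = (c \<bullet> x) powr q"

text \<open>The cube \<open>v\<^sub>0 + u [0,1]\<^sup>d\<close>; \<open>1 :: real ^ 'n\<close> is the all-ones vector.\<close>
definition shifted_cube :: "real ^ 'n \<Rightarrow> real \<Rightarrow> (real ^ 'n) set" where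
  "shifted_cube v0 u = (\<lambda>x. v0 + u *\<^sub>R x) ` cbox 0 1"

text \<open>
  Stated with \<open>Sup\<close>, since \<open>Max\<close> is for finite sets.
\<close>
definition max_on :: "('a \<Rightarrow> real) \<Rightarrow> 'a set \<Rightarrow> real" where
  "max_on f Q = (SUP x\<in>Q. f x)"

end

theory Submission imports Defs begin

text \<open>
  Write \<open>d\<close> for the dimension, \<open>V\<close> for the volume of \<open>Q\<^sub>u\<close> and \<open>I\<close> for the integral of \<open>f\<close> over
  \<open>Q\<^sub>u\<close>. Slicing both relaxations at height \<open>z\<close> and substituting \<open>x = z w\<close> gives the volumes
  \<open>F V / (d + 2) - I / (q + d + 1)\<close> for the naive relaxation, since \<open>f\<close> is homogeneous of degree
  \<open>q\<close>, and \<open>(F V - I) / (d + 2)\<close> for the perspective relaxation, whose defining set is convex because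
  \<open>f\<close> is (\<open>measure_scaled_region\<close>, \<open>vol_naive_relaxation\<close>, \<open>vol_perspective_relaxation\<close>). Hence the
  relative gap is
  \<open>(q - 1) R / ((q + d + 1) - (d + 2) R)\<close> with \<open>R = I / (F V)\<close>, an increasing function of \<open>R \<le> 1\<close>
  (\<open>gap_ratio_shifted_cube\<close>). Rescaling by \<open>u\<close> shows that \<open>R\<close> converges to
  \<open>R\<^sub>0 = (\<integral> (c \<bullet> x)\<^sup>q dx) / (c \<bullet> 1)\<^sup>q\<close>, the integral being over the unit cube, and it remains to bound
  \<open>R\<^sub>0\<close> from below.

  Integrating one coordinate after the other expresses the integral of \<open>(k + c \<bullet> x)\<^sup>q\<close> over the
  unit cube as the \<open>d\<close>-fold mixed difference of \<open>x\<^bsup>q + d\<^esup>\<close> at \<open>k\<close> with steps \<open>c\<^sub>1, \<dots>, c\<^sub>d\<close>, divided by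
  \<open>c\<^sub>1 \<cdots> c\<^sub>d (q + 1) \<cdots> (q + d)\<close> (\<open>nn_integral_cube_powr\<close>). This difference is at least
  \<open>d! c\<^sub>1 \<cdots> c\<^sub>d \<Sum>\<^sub>j (k + j m)\<^sup>q\<close>, with \<open>j\<close> from \<open>0\<close> to \<open>d\<close> and \<open>m\<close> the mean of the steps
  (\<open>mixed_diff_powr_ge_sum\<close>); the proof is by induction on the number of steps and uses only a Leibniz
  rule for differences, monotonicity of \<open>x\<^bsup>q - 1\<^esup>\<close> and Jensen's inequality. At \<open>k = 0\<close> it is the
  required bound.
\<close>

section \<open>Mixed differences of powers\<close>

text \<open>
  The mixed forward difference of \<open>g\<close> at \<open>k\<close> with one step \<open>a i\<close> for each \<open>i \<in> S\<close>, that is,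
  \<open>\<Prod>\<^sub>i (E\<^bsub>a i\<^esub> - 1)\<close> applied to \<open>g\<close>, where \<open>E\<^bsub>h\<^esub>\<close> is the shift by \<open>h\<close>; it is written out
  by inclusion-exclusion over the set \<open>T\<close> of steps that are taken.
\<close>
definition mixed_diff :: "('b \<Rightarrow> real) \<Rightarrow> (real \<Rightarrow> real) \<Rightarrow> 'b set \<Rightarrow> real \<Rightarrow> real" where
  "mixed_diff a g S k = (\<Sum>T\<in>Pow S. (-1) ^ card (S - T) * g (k + sum a T))"

lemma mixed_diff_empty [simp]: "mixed_diff a g {} k = g k"
  by (simp add: mixed_diff_def)

lemma mixed_diff_insert:
  assumes "finite S" "i \<notin> S"
  shows "mixed_diff a g (insert i S) k = mixed_diff a g S (k + a i) - mixed_diff a g S k"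
proof -
  let ?h = "\<lambda>T. (-1) ^ card (insert i S - T) * g (k + sum a T)"
  have inj: "inj_on (insert i) (Pow S)"
    using assms(2) by (intro inj_onI) (metis Pow_iff insert_ident subset_iff)
  have "mixed_diff a g (insert i S) k = sum ?h (Pow S) + sum ?h (insert i ` Pow S)"
    unfolding mixed_diff_def Pow_insert using assms
    by (intro sum.union_disjoint) auto
  also have "sum ?h (insert i ` Pow S) = mixed_diff a g S (k + a i)"
    unfolding mixed_diff_def
  proof (subst sum.reindex[OF inj], rule sum.cong[OF refl])
    fix T assume T: "T \<in> Pow S"
    then have "insert i S - insert i T = S - T" "finite T" "i \<notin> T"
      using assms by (auto intro: finite_subset)
    then show "(?h \<circ> insert i) T = (-1) ^ card (S - T) * g (k + a i + sum a T)"
      by (simp add: add.assoc)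
  qed
  also have "sum ?h (Pow S) = - mixed_diff a g S k"
    unfolding mixed_diff_def sum_negf[symmetric]
  proof (rule sum.cong[OF refl])
    fix T assume T: "T \<in> Pow S"
    then have "insert i S - T = insert i (S - T)" "i \<notin> S - T" "finite (S - T)"
      using assms by auto
    then show "?h T = - ((-1) ^ card (S - T) * g (k + sum a T))"
      by simp
  qed
  finally show ?thesis by simp
qed

text \<open>
  The Leibniz rule for multiplication by the identity. It splits off the contribution of the base
  point \<open>k\<close> and removes one step from each remaining difference, which drives the induction in
  \<open>mixed_diff_powr_ge_sum\<close>.
\<close>
lemma mixed_diff_times_id:
  assumes "finite S"
  shows "mixed_diff a (\<lambda>x. x * g x) S k =
           k * mixed_diff a g S k + (\<Sum>i\<in>S. a i * mixed_diff a g (S - {i}) (k + a i))"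
  using assms
proof (induction S arbitrary: k rule: finite_induct)
  case (insert j S)
  have rest: "mixed_diff a g (insert j S - {i}) (k + a i) =
      mixed_diff a g (S - {i}) (k + a j + a i) - mixed_diff a g (S - {i}) (k + a i)"
    if "i \<in> S" for i
  proof -
    have "insert j S - {i} = insert j (S - {i})" using that insert.hyps by auto
    then show ?thesis
      using insert.hyps by (simp add: mixed_diff_insert algebra_simps)
  qed
  have "insert j S - {j} = S" using insert.hyps by auto
  then show ?case
    using insert.hyps
    by (simp add: mixed_diff_insert insert.IH rest algebra_simps sum_subtractf)
qed simp

lemma mixed_diff_cong:
  assumes "k \<ge> 0" "\<And>i. i \<in> S \<Longrightarrow> a i \<ge> 0" "\<And>x. x \<ge> 0 \<Longrightarrow> g x = h x"
  shows "mixed_diff a g S k = mixed_diff a h S k"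
  unfolding mixed_diff_def
proof (rule sum.cong[OF refl])
  fix T assume "T \<in> Pow S"
  then have "sum a T \<ge> 0" using assms(2) by (intro sum_nonneg) auto
  then show "(-1) ^ card (S - T) * g (k + sum a T) = (-1) ^ card (S - T) * h (k + sum a T)"
    using assms by simp
qed

lemma DERIV_mixed_diff_powr:
  assumes "k > 0" "\<And>i. i \<in> S \<Longrightarrow> a i > 0"
  shows "((\<lambda>k. mixed_diff a (\<lambda>x. x powr (p + 1)) S k) has_real_derivative
           (p + 1) * mixed_diff a (\<lambda>x. x powr p) S k) (at k)"
proof -
  have "k + sum a T > 0" if "T \<in> Pow S" for T
  proof -
    have "sum a T \<ge> 0" using that assms(2) by (intro sum_nonneg) (auto intro: less_imp_le)
    then show ?thesis using assms by simp
  qed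
  then show ?thesis
    unfolding mixed_diff_def
    by (auto intro!: derivative_eq_intros simp: sum_distrib_left algebra_simps)
qed

text \<open>
  The difference of order \<open>n\<close> is \<open>\<Prod>\<^sub>i a i\<close> times an average of the \<open>n\<close>-th derivative
  \<open>(p + 1) \<cdots> (p + n) x\<^sup>p\<close> over points to the right of \<open>k\<close>, and this derivative is
  nondecreasing since \<open>p \<ge> 0\<close>.
\<close>
lemma mixed_diff_powr_ge:
  fixes p :: real
  assumes "finite S" "k > 0" "p \<ge> 0" "\<And>i. i \<in> S \<Longrightarrow> a i > 0"
  shows "mixed_diff a (\<lambda>x. x powr (p + card S)) S k
           \<ge> prod a S * pochhammer (p + 1) (card S) * k powr p"
  using assms(1,2,4)
proof (induction S arbitrary: k rule: finite_induct)
  case (insert j S)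
  let ?n = "card S" and ?D = "\<lambda>r. mixed_diff a (\<lambda>x. x powr r) S"
  have "\<exists>z. k < z \<and> z < k + a j \<and>
      ?D (p + ?n + 1) (k + a j) - ?D (p + ?n + 1) k =
      (k + a j - k) * ((p + ?n + 1) * ?D (p + ?n) z)"
    using insert.prems by (intro MVT2 DERIV_mixed_diff_powr) auto
  then obtain z where z: "k < z" and
    eq: "?D (p + ?n + 1) (k + a j) - ?D (p + ?n + 1) k = a j * ((p + ?n + 1) * ?D (p + ?n) z)"
    by auto
  have "prod a S * pochhammer (p + 1) ?n * k powr p \<le> prod a S * pochhammer (p + 1) ?n * z powr p"
    using z insert.prems assms(3)
    by (intro mult_left_mono powr_mono2 mult_nonneg_nonneg prod_nonneg)
       (auto intro: less_imp_le pochhammer_nonneg)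
  also have "\<dots> \<le> ?D (p + ?n) z"
    using z insert.prems by (intro insert.IH) auto
  finally have "a j * ((p + ?n + 1) * (prod a S * pochhammer (p + 1) ?n * k powr p))
      \<le> a j * ((p + ?n + 1) * ?D (p + ?n) z)"
    using insert.prems assms(3) by (intro mult_left_mono) (auto intro: less_imp_le)
  then show ?case
    using insert.hyps eq by (simp add: mixed_diff_insert pochhammer_Suc algebra_simps)
qed simp


lemma fact_le_pochhammer:
  assumes "x \<ge> (1::real)" shows "fact n \<le> pochhammer x n"
proof (induction n)
  case (Suc n)
  have "fact (Suc n) = fact n * (1 + real n)" by (simp add: algebra_simps)
  also have "\<dots> \<le> pochhammer x n * (x + real n)"
    using Suc assms by (intro mult_mono) (auto intro: pochhammer_nonneg)
  finally show ?case by (simp add: pochhammer_Suc)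
qed simp

text \<open>
  The inequality at the heart of the theorem. The Leibniz rule for \<open>x\<^bsup>q + n\<^esup> = x \<cdot> x\<^bsup>q + n - 1\<^esup>\<close> yields
  one term at \<open>k\<close>, which accounts for \<open>j = 0\<close> by \<open>mixed_diff_powr_ge\<close> with \<open>p = q - 1\<close>, and for each
  \<open>i \<in> S\<close> a difference over \<open>S - {i}\<close>, to which the induction hypothesis applies. Averaging over \<open>i\<close>
  replaces the steps by their mean, by convexity of \<open>x\<^sup>q\<close>; this gives the terms \<open>j \<ge> 1\<close>.
  For empty \<open>S\<close> the mean is \<open>0 / 0 = 0\<close> and only multiplies \<open>j = 0\<close>.
\<close>
lemma mixed_diff_powr_ge_sum:
  fixes q :: real
  assumes "finite S" "k \<ge> 0" "q \<ge> 1" "\<And>i. i \<in> S \<Longrightarrow> a i > 0"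
  shows "mixed_diff a (\<lambda>x. x powr (q + card S)) S k \<ge>
           fact (card S) * prod a S * (\<Sum>j\<le>card S. (k + j * (sum a S / card S)) powr q)"
  using assms(1,2,4)
proof (induction "card S" arbitrary: S k)
  case 0
  then show ?case by simp
next
  case (Suc m S)
  define \<sigma> where "\<sigma> = sum a S / Suc m"
  have fin: "finite S" and card: "card S = Suc m" and ne: "S \<noteq> {}" and pos: "prod a S > 0"
    using Suc by (auto intro: prod_pos)
  have sum_a: "sum a S = \<sigma> * Suc m" by (simp add: \<sigma>_def)
  let ?g = "\<lambda>x. x powr (q + m)"
  have "mixed_diff a (\<lambda>x. x powr (q + card S)) S k = mixed_diff a (\<lambda>x. x * ?g x) S k"
    using Suc.prems card by (intro mixed_diff_cong) (auto simp: powr_mult_base less_imp_le add_ac)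
  also have "\<dots> = k * mixed_diff a ?g S k + (\<Sum>i\<in>S. a i * mixed_diff a ?g (S - {i}) (k + a i))"
    by (rule mixed_diff_times_id[OF fin])
  finally have eq: "mixed_diff a (\<lambda>x. x powr (q + card S)) S k = \<dots>" .
  have first: "fact (Suc m) * prod a S * k powr q \<le> k * mixed_diff a ?g S k"
  proof (cases "k = 0")
    case False
    then have k: "k > 0" using Suc.prems by simp
    have "fact (Suc m) * prod a S * k powr q = k * (prod a S * fact (Suc m) * k powr (q - 1))"
      using k by (simp add: powr_diff)
    also have "\<dots> \<le> k * (prod a S * pochhammer (q - 1 + 1) (Suc m) * k powr (q - 1))"
      using k pos fact_le_pochhammer[OF assms(3), of "Suc m"]
      by (intro mult_left_mono mult_right_mono) auto
    also have "\<dots> \<le> k * mixed_diff a ?g S k"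
      using mixed_diff_powr_ge[OF fin k, of "q - 1" a] Suc.prems k assms(3)
      by (intro mult_left_mono) (auto simp: card)
    finally show ?thesis .
  qed simp
  have second: "a i * mixed_diff a ?g (S - {i}) (k + a i) \<ge>
      fact m * prod a S * (\<Sum>j\<le>m. (k + a i + j * ((sum a S - a i) / m)) powr q)"
    if i: "i \<in> S" for i
  proof -
    have c: "card (S - {i}) = m" using card fin i by simp
    have "mixed_diff a ?g (S - {i}) (k + a i) \<ge> fact m * prod a (S - {i}) *
        (\<Sum>j\<le>m. (k + a i + j * (sum a (S - {i}) / m)) powr q)"
      using Suc.hyps(1)[of "S - {i}" "k + a i"] Suc.prems i c
      by (auto simp: less_imp_le)
    then have "a i * (fact m * prod a (S - {i}) *
        (\<Sum>j\<le>m. (k + a i + j * (sum a (S - {i}) / m)) powr q))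
          \<le> a i * mixed_diff a ?g (S - {i}) (k + a i)"
      using Suc.prems i by (intro mult_left_mono) (auto intro: less_imp_le)
    moreover have "prod a S = a i * prod a (S - {i})" "sum a (S - {i}) = sum a S - a i"
      using fin i by (simp_all add: prod.remove sum_diff1)
    ultimately show ?thesis by (simp add: mult_ac)
  qed
  have jensen: "Suc m * (k + Suc j * \<sigma>) powr q \<le>
      (\<Sum>i\<in>S. (k + a i + j * ((sum a S - a i) / m)) powr q)" if j: "j \<le> m" for j
  proof -
    let ?y = "\<lambda>i. k + a i + j * ((sum a S - a i) / m)"
    have y_pos: "?y i > 0" if i: "i \<in> S" for i
    proof -
      have "sum a S - a i = sum a (S - {i})" using fin i by (simp add: sum_diff1)
      also have "\<dots> \<ge> 0" using Suc.prems by (intro sum_nonneg) (auto intro: less_imp_le)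
      finally show ?thesis using Suc.prems i by (intro add_pos_nonneg add_nonneg_pos) auto
    qed
    have "(\<Sum>i\<in>S. sum a S - a i) = m * sum a S"
      using card by (simp add: sum_subtractf algebra_simps)
    then have "(\<Sum>i\<in>S. ?y i) = Suc m * k + sum a S + j * (m * sum a S / m)"
      using card by (simp add: sum.distrib flip: sum_distrib_left sum_divide_distrib)
    \<comment> \<open>For \<open>m = 0\<close> division yields \<open>0\<close>, but then \<open>j = 0\<close> as well.\<close>
    also have "j * (m * sum a S / m) = j * sum a S" using j by (cases "m = 0") auto
    finally have mean: "(\<Sum>i\<in>S. (1 / Suc m) *\<^sub>R ?y i) = k + Suc j * \<sigma>"
      by (simp add: sum_a flip: sum_divide_distrib) (simp add: field_simps)
    have "(\<Sum>i\<in>S. (1 / Suc m) *\<^sub>R ?y i) powr q \<le> (\<Sum>i\<in>S. 1 / Suc m * ?y i powr q)"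
      using fin ne card y_pos
      by (intro convex_on_sum[OF _ _ powr_convex[OF assms(3)]]) auto
    then show ?thesis unfolding mean
      by (simp add: field_simps flip: sum_divide_distrib)
  qed
  have "fact (Suc m) * prod a S * (\<Sum>j\<le>Suc m. (k + j * \<sigma>) powr q) =
      fact (Suc m) * prod a S * k powr q + fact m * prod a S * (\<Sum>j\<le>m. Suc m * (k + Suc j * \<sigma>) powr q)"
    by (simp only: sum.atMost_Suc_shift) (simp add: algebra_simps sum_distrib_left sum.distrib)
  also have "\<dots> \<le> k * mixed_diff a ?g S k + fact m * prod a S *
      (\<Sum>j\<le>m. \<Sum>i\<in>S. (k + a i + j * ((sum a S - a i) / m)) powr q)"
    using first pos jensen by (intro add_mono mult_left_mono sum_mono) auto
  also have "\<dots> = k * mixed_diff a ?g S k + (\<Sum>i\<in>S. fact m * prod a S *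
      (\<Sum>j\<le>m. (k + a i + j * ((sum a S - a i) / m)) powr q))"
    by (subst sum.swap) (simp add: sum_distrib_left)
  also have "\<dots> \<le> mixed_diff a (\<lambda>x. x powr (q + card S)) S k"
    unfolding eq using second by (intro add_mono sum_mono) auto
  finally show ?case by (simp add: card \<sigma>_def)
qed

section \<open>Integrals of powers of linear forms over the unit cube\<close>

text \<open>
  Integrating out the coordinate \<open>j\<close> turns a difference over \<open>S\<close> of a power into a difference over
  \<open>insert j S\<close> of the next power. The base point \<open>k\<close> is kept positive so that all powers are
  differentiable on the cube.
\<close>
lemma nn_integral_PiM_cube_powr:
  fixes q :: real and a :: "'b \<Rightarrow> real"
  assumes "finite S" "k > 0" "q \<ge> 0" "\<And>i. i \<in> S \<Longrightarrow> a i > 0"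
  shows "(\<integral>\<^sup>+x. ennreal ((k + (\<Sum>i\<in>S. a i * x i)) powr q) * (\<Prod>i\<in>S. indicator {0..1} (x i))
            \<partial>Pi\<^sub>M S (\<lambda>_. lborel)) =
         ennreal (mixed_diff a (\<lambda>x. x powr (q + card S)) S k /
                  (prod a S * pochhammer (q + 1) (card S)))"
  using assms(1,2,4)
proof (induction S arbitrary: k rule: finite_induct)
  case empty
  then show ?case by (simp add: PiM_empty nn_integral_count_space_finite)
next
  case (insert j S)
  interpret product_sigma_finite "\<lambda>_::'b. lborel :: real measure" by standard
  let ?D = "\<lambda>r. mixed_diff a (\<lambda>x. x powr r) S" and ?n = "card S"
  let ?N = "\<lambda>k. ?D (q + ?n) k / (prod a S * pochhammer (q + 1) ?n)"
  let ?J = "\<lambda>x. ennreal ((k + (\<Sum>i\<in>insert j S. a i * x i)) powr q) *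
      (\<Prod>i\<in>insert j S. indicator {0..1} (x i))"
  have pos: "a j > 0" "prod a S > 0" "pochhammer (q + 1) ?n > 0"
    using insert.prems assms(3) by (auto intro!: prod_pos pochhammer_pos)
  have "(\<integral>\<^sup>+x. ?J x \<partial>Pi\<^sub>M (insert j S) (\<lambda>_. lborel)) =
      (\<integral>\<^sup>+y. \<integral>\<^sup>+x. ?J (x(j := y)) \<partial>Pi\<^sub>M S (\<lambda>_. lborel) \<partial>lborel)"
    using insert.hyps by (intro product_nn_integral_insert_rev) auto
  also have "\<dots> = (\<integral>\<^sup>+y. ennreal (?N (k + a j * y)) * indicator {0..1} y \<partial>lborel)"
  proof (rule nn_integral_cong)
    fix y :: real
    have "?J (x(j := y)) = indicator {0..1} y *
        (ennreal ((k + a j * y + (\<Sum>i\<in>S. a i * x i)) powr q) * (\<Prod>i\<in>S. indicator {0..1} (x i)))" for x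
    proof -
      have "(\<Sum>i\<in>S. a i * (x(j := y)) i) = (\<Sum>i\<in>S. a i * x i)"
        using insert.hyps by (intro sum.cong) auto
      moreover have "(\<Prod>i\<in>S. indicator {0..1} ((x(j := y)) i) :: ennreal) = (\<Prod>i\<in>S. indicator {0..1} (x i))"
        using insert.hyps by (intro prod.cong) auto
      ultimately show ?thesis using insert.hyps by (simp add: add.assoc mult_ac)
    qed
    then have "(\<integral>\<^sup>+x. ?J (x(j := y)) \<partial>Pi\<^sub>M S (\<lambda>_. lborel)) = indicator {0..1} y *
        (\<integral>\<^sup>+x. ennreal ((k + a j * y + (\<Sum>i\<in>S. a i * x i)) powr q) *
           (\<Prod>i\<in>S. indicator {0..1} (x i)) \<partial>Pi\<^sub>M S (\<lambda>_. lborel))"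
      by (simp only:) (rule nn_integral_cmult, measurable)
    also have "\<dots> = ennreal (?N (k + a j * y)) * indicator {0..1} y"
    proof (cases "y \<in> {0..1}")
      case True
      then have "k + a j * y > 0" using insert.prems(1) pos by (intro add_pos_nonneg mult_nonneg_nonneg) auto
      then show ?thesis using insert.IH insert.prems by (simp add: mult.commute)
    qed simp
    finally show "(\<integral>\<^sup>+x. ?J (x(j := y)) \<partial>Pi\<^sub>M S (\<lambda>_. lborel)) = \<dots>" .
  qed
  also have "\<dots> = ennreal (?D (q + ?n + 1) (k + a j * 1) / ((q + ?n + 1) * a j * prod a S * pochhammer (q + 1) ?n)
       - ?D (q + ?n + 1) (k + a j * 0) / ((q + ?n + 1) * a j * prod a S * pochhammer (q + 1) ?n))"
  proof (rule nn_integral_FTC_Icc)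
    fix y :: real assume y: "y \<in> {0..1}"
    have ky: "k + a j * y > 0" using y insert.prems(1) pos by (intro add_pos_nonneg mult_nonneg_nonneg) auto
    have "((\<lambda>y. ?D (q + ?n + 1) (k + a j * y)) has_real_derivative
        (q + ?n + 1) * ?D (q + ?n) (k + a j * y) * a j) (at y)"
      using insert.prems ky
      by (intro DERIV_chain'[where f = "\<lambda>y. k + a j * y" and g = "?D (q + ?n + 1)"] DERIV_mixed_diff_powr)
         (auto intro!: derivative_eq_intros)
    from DERIV_cdivide[OF this, of "(q + ?n + 1) * a j * prod a S * pochhammer (q + 1) ?n"]
    have "((\<lambda>y. ?D (q + ?n + 1) (k + a j * y) / ((q + ?n + 1) * a j * prod a S * pochhammer (q + 1) ?n))
      has_real_derivative (q + ?n + 1) * ?D (q + ?n) (k + a j * y) * a j /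
        ((q + ?n + 1) * a j * prod a S * pochhammer (q + 1) ?n)) (at y)" .
    also have "(q + ?n + 1) * ?D (q + ?n) (k + a j * y) * a j /
        ((q + ?n + 1) * a j * prod a S * pochhammer (q + 1) ?n) = ?N (k + a j * y)"
    proof -
      have "q + ?n + 1 \<noteq> 0" "a j \<noteq> 0" using pos assms(3) by auto
      then show ?thesis by (simp only: mult.assoc mult.left_commute[of _ "a j"]) simp
    qed
    finally show "((\<lambda>y. ?D (q + ?n + 1) (k + a j * y) / ((q + ?n + 1) * a j * prod a S * pochhammer (q + 1) ?n))
      has_real_derivative ?N (k + a j * y)) (at y)" .
    have "0 \<le> prod a S * pochhammer (q + 1) ?n * (k + a j * y) powr q"
      using pos by simp
    also have "\<dots> \<le> ?D (q + ?n) (k + a j * y)"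
      using insert ky assms(3) by (intro mixed_diff_powr_ge) auto
    finally show "0 \<le> ?N (k + a j * y)" using pos by simp
  next
    show "(\<lambda>y. ?N (k + a j * y)) \<in> borel_measurable borel"
      unfolding mixed_diff_def by measurable
  qed simp
  also have "\<dots> = ennreal (mixed_diff a (\<lambda>x. x powr (q + card (insert j S))) (insert j S) k /
       (prod a (insert j S) * pochhammer (q + 1) (card (insert j S))))"
    using insert.hyps pos assms(3)
    by (simp add: mixed_diff_insert pochhammer_Suc add_ac diff_divide_distrib mult_ac)
  finally show ?case .
qed

lemma nn_integral_cube_powr:
  fixes q :: real and c :: "'a::euclidean_space"
  assumes "k > 0" "q \<ge> 0" "\<And>b. b \<in> Basis \<Longrightarrow> c \<bullet> b > 0"
  shows "(\<integral>\<^sup>+x. ennreal ((k + c \<bullet> x) powr q) * indicator (cbox 0 One) x \<partial>lborel) =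
         ennreal (mixed_diff (\<lambda>b. c \<bullet> b) (\<lambda>x. x powr (q + DIM('a))) Basis k /
                  ((\<Prod>b\<in>Basis. c \<bullet> b) * pochhammer (q + 1) DIM('a)))"
proof -
  let ?v = "\<lambda>x::'a \<Rightarrow> real. \<Sum>b\<in>Basis. x b *\<^sub>R b"
  have "(\<integral>\<^sup>+x. ennreal ((k + c \<bullet> x) powr q) * indicator (cbox 0 One) x \<partial>lborel) =
      (\<integral>\<^sup>+x. ennreal ((k + c \<bullet> ?v x) powr q) * indicator (cbox 0 One) (?v x) \<partial>Pi\<^sub>M Basis (\<lambda>_. lborel))"
    by (subst lborel_eq) (rule nn_integral_distr; measurable)
  also have "\<dots> = (\<integral>\<^sup>+x. ennreal ((k + (\<Sum>b\<in>Basis. (c \<bullet> b) * x b)) powr q) *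
      (\<Prod>b\<in>Basis. indicator {0..1} (x b)) \<partial>Pi\<^sub>M (Basis :: 'a set) (\<lambda>_. lborel))"
  proof (rule nn_integral_cong)
    fix x :: "'a \<Rightarrow> real"
    have "c \<bullet> ?v x = (\<Sum>b\<in>Basis. (c \<bullet> b) * x b)"
      by (simp add: inner_sum_right mult.commute)
    moreover have "indicator (cbox 0 One) (?v x) = (\<Prod>b\<in>Basis. indicator {0..1} (x b) :: ennreal)"
    proof (cases "\<forall>b\<in>Basis. x b \<in> {0..1}")
      case True
      then show ?thesis by (simp add: mem_box)
    next
      case False
      then obtain b where b: "b \<in> Basis" "x b \<notin> {0..1}" by blast
      then have "(\<Prod>b\<in>Basis. indicator {0..1} (x b) :: ennreal) = 0"
        by (intro prod_zero bexI[of _ b]) auto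
      moreover have "?v x \<notin> cbox 0 One" using b by (auto simp: mem_box)
      ultimately show ?thesis by simp
    qed
    ultimately show "ennreal ((k + c \<bullet> ?v x) powr q) * indicator (cbox 0 One) (?v x) =
        ennreal ((k + (\<Sum>b\<in>Basis. (c \<bullet> b) * x b)) powr q) * (\<Prod>b\<in>Basis. indicator {0..1} (x b))"
      by simp
  qed
  also have "\<dots> = ennreal (mixed_diff (\<lambda>b. c \<bullet> b) (\<lambda>x. x powr (q + DIM('a))) Basis k /
                  ((\<Prod>b\<in>Basis. c \<bullet> b) * pochhammer (q + 1) DIM('a)))"
    using assms by (intro nn_integral_PiM_cube_powr) auto
  finally show ?thesis .
qed

section \<open>Regions between homogeneous bounds over a cone\<close>

lemma nn_integral_lborel_affine:
  fixes f :: "'a::euclidean_space \<Rightarrow> ennreal"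
  assumes [measurable]: "f \<in> borel_measurable borel" and "c \<noteq> 0"
  shows "(\<integral>\<^sup>+x. f x \<partial>lborel) = ennreal (\<bar>c\<bar> ^ DIM('a)) * (\<integral>\<^sup>+x. f (t + c *\<^sub>R x) \<partial>lborel)"
  by (subst lborel_affine[OF assms(2), of t])
     (simp add: nn_integral_density nn_integral_distr nn_integral_cmult)

text \<open>
  The region over the cone of all \<open>(x, z)\<close> with \<open>0 < z \<le> 1\<close> and \<open>x \<in> z \<cdot> Q\<close> that lies between the
  lower bound \<open>z\<^sup>r g(x/z)\<close> and the upper bound \<open>z F\<close>. For \<open>r = 1\<close> the lower bound is the perspective
  of \<open>g\<close>; if \<open>g\<close> is homogeneous of degree \<open>r\<close>, it is \<open>g\<close> itself. Up to null sets, both relaxations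
  are therefore instances of this region.
\<close>
definition scaled_region ::
  "('a::euclidean_space \<Rightarrow> real) \<Rightarrow> 'a set \<Rightarrow> real \<Rightarrow> real \<Rightarrow> ('a \<times> real \<times> real) set" where
  "scaled_region g Q F r = {(x, y, z). 0 < z \<and> z \<le> 1 \<and> x /\<^sub>R z \<in> Q \<and>
     z powr r * g (x /\<^sub>R z) \<le> y \<and> y \<le> z * F}"

lemma scaled_region_borel:
  assumes [measurable]: "g \<in> borel_measurable borel" "Q \<in> sets borel"
  shows "scaled_region g Q F r \<in> sets borel"
proof -
  have "Measurable.pred borel (\<lambda>p::'a::euclidean_space \<times> real \<times> real. 0 < snd (snd p) \<and> snd (snd p) \<le> 1 \<and>
     fst p /\<^sub>R snd (snd p) \<in> Q \<and>
     snd (snd p) powr r * g (fst p /\<^sub>R snd (snd p)) \<le> fst (snd p) \<and> fst (snd p) \<le> snd (snd p) * F)"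
    unfolding borel_prod[symmetric] by measurable
  then show ?thesis
    by (simp add: scaled_region_def case_prod_beta' pred_def)
qed

text \<open>
  After the substitution \<open>x = z w\<close>, the slice at height \<open>z\<close> has volume
  \<open>z\<^sup>d (z F V - z\<^sup>r I)\<close>, where \<open>V\<close> is the volume of \<open>Q\<close> and \<open>I\<close> the integral of \<open>g\<close> over \<open>Q\<close>.
\<close>
lemma measure_scaled_region:
  fixes g :: "'a::euclidean_space \<Rightarrow> real"
  assumes [measurable]: "g \<in> borel_measurable borel" "Q \<in> sets borel"
    and V: "emeasure lborel Q = ennreal V" "V \<ge> 0"
    and I: "(\<integral>\<^sup>+x. ennreal (g x) * indicator Q x \<partial>lborel) = ennreal I" "I \<ge> 0"
    and g: "\<And>x. x \<in> Q \<Longrightarrow> 0 \<le> g x" "\<And>x. x \<in> Q \<Longrightarrow> g x \<le> F"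
    and r: "r \<ge> 1" and "F \<ge> 0"
  shows "measure lebesgue (scaled_region g Q F r) = F * V / (DIM('a) + 2) - I / (r + DIM('a) + 1)"
proof -
  let ?d = "DIM('a)"
  let ?A = "scaled_region g Q F r"
  have [measurable]: "?A \<in> sets borel" by (rule scaled_region_borel) fact+
  have "ennreal I \<le> (\<integral>\<^sup>+x. ennreal F * indicator Q x \<partial>lborel)"
    unfolding I(1)[symmetric] using g
    by (intro nn_integral_mono) (auto split: split_indicator intro: ennreal_leI)
  also have "\<dots> = ennreal (F * V)"
    using V \<open>F \<ge> 0\<close> by (simp add: nn_integral_cmult_indicator ennreal_mult)
  finally have I_le: "I \<le> F * V" using V \<open>F \<ge> 0\<close> by simp
  \<comment> \<open>As \<open>r \<ge> 1\<close>, the lower bound never exceeds the upper bound.\<close>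
  have scale: "z powr r * t \<le> z * s" if "0 < z" "z \<le> 1" "0 \<le> t" "t \<le> s" for z s t :: real
  proof -
    have "z powr r \<le> z powr 1" using that r by (intro powr_mono') auto
    then show ?thesis using that by (intro mult_mono) auto
  qed
  have slice: "(\<integral>\<^sup>+y. \<integral>\<^sup>+x. indicator ?A (x, y, z) \<partial>lborel \<partial>lborel) =
      ennreal (F * V * z powr (?d + 1) - I * z powr (r + ?d))" if z: "0 < z" "z \<le> 1" for z
  proof -
    have [measurable]: "(\<lambda>p :: 'a \<times> real. (fst p, snd p, z)) \<in> borel \<rightarrow>\<^sub>M borel"
      by (intro borel_measurable_continuous_onI continuous_intros)
    have meas: "(\<lambda>p :: 'a \<times> real. indicator ?A (fst p, snd p, z) :: ennreal) \<in> borel_measurable borel"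
      by measurable
    have "(\<integral>\<^sup>+y. \<integral>\<^sup>+x. indicator ?A (x, y, z) \<partial>lborel \<partial>lborel) =
        (\<integral>\<^sup>+x. \<integral>\<^sup>+y. indicator ?A (x, y, z) \<partial>lborel \<partial>lborel)"
      by (rule lborel_pair.Fubini') (use meas in \<open>simp add: case_prod_beta' borel_prod\<close>)
    also have "\<dots> = (\<integral>\<^sup>+x. ennreal (z * F - z powr r * g (x /\<^sub>R z)) * indicator Q (x /\<^sub>R z) \<partial>lborel)"
    proof (rule nn_integral_cong)
      fix x :: 'a
      have "(\<integral>\<^sup>+y. indicator ?A (x, y, z) \<partial>lborel) =
          (\<integral>\<^sup>+y. indicator Q (x /\<^sub>R z) * indicator {z powr r * g (x /\<^sub>R z)..z * F} y \<partial>lborel)"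
        using z by (intro nn_integral_cong) (auto simp: scaled_region_def indicator_def)
      also have "\<dots> = ennreal (z * F - z powr r * g (x /\<^sub>R z)) * indicator Q (x /\<^sub>R z)"
        using scale[OF z g, of "x /\<^sub>R z"]
        by (auto simp: nn_integral_cmult_indicator split: split_indicator)
      finally show "(\<integral>\<^sup>+y. indicator ?A (x, y, z) \<partial>lborel) = \<dots>" .
    qed
    also have "\<dots> = ennreal (z ^ ?d) * (\<integral>\<^sup>+x. ennreal (z * F - z powr r * g x) * indicator Q x \<partial>lborel)"
      using z by (subst nn_integral_lborel_affine[where c = z and t = 0]) auto
    also have "(\<integral>\<^sup>+x. ennreal (z * F - z powr r * g x) * indicator Q x \<partial>lborel) =
        (\<integral>\<^sup>+x. ennreal (z * F) * indicator Q x - ennreal (z powr r) * (ennreal (g x) * indicator Q x) \<partial>lborel)"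
      using z g(1) by (intro nn_integral_cong)
        (auto split: split_indicator simp: ennreal_minus simp flip: ennreal_mult)
    also have "\<dots> = (\<integral>\<^sup>+x. ennreal (z * F) * indicator Q x \<partial>lborel) -
        (\<integral>\<^sup>+x. ennreal (z powr r) * (ennreal (g x) * indicator Q x) \<partial>lborel)"
    proof (rule nn_integral_diff)
      show "AE x in lborel. ennreal (z powr r) * (ennreal (g x) * indicator Q x) \<le> ennreal (z * F) * indicator Q x"
        using scale[OF z g] z g(1)
        by (intro AE_I2) (auto split: split_indicator simp flip: ennreal_mult intro!: ennreal_leI)
    qed (simp_all add: nn_integral_cmult I flip: ennreal_mult)
    also have "\<dots> = ennreal (z * F * V - z powr r * I)"
      using z V I \<open>F \<ge> 0\<close> 
      by (simp add: nn_integral_cmult_indicator nn_integral_cmult ennreal_minus flip: ennreal_mult)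
    also have "ennreal (z ^ ?d) * \<dots> = ennreal (F * V * z powr (?d + 1) - I * z powr (r + ?d))"
    proof -
      have "z ^ ?d * (z * F * V - z powr r * I) = F * V * z powr (?d + 1) - I * z powr (r + ?d)"
        using z by (simp add: powr_add powr_realpow algebra_simps)
      then show ?thesis using z by (simp add: ennreal_mult'[symmetric])
    qed
    finally show ?thesis .
  qed
  have int: "((\<lambda>z. F * V * z powr (?d + 1) - I * z powr (r + ?d)) has_integral
      F * V / (?d + 2) - I / (r + ?d + 1)) {0..1}"
    using has_integral_diff[OF has_integral_mult_right[OF has_integral_powr_from_0[of "?d + 1" 1]]
        has_integral_mult_right[OF has_integral_powr_from_0[of "r + ?d" 1]], of "F * V" I] r
    by (simp add: add_ac)
  have nonneg: "0 \<le> F * V * z powr (?d + 1) - I * z powr (r + ?d)" if "z \<in> {0..1}" for z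
  proof -
    have "I * z powr (r + ?d) \<le> (F * V) * z powr (?d + 1)"
      using that r I_le I V \<open>F \<ge> 0\<close>
      by (intro mult_mono powr_mono') auto
    then show ?thesis by simp
  qed
  have "emeasure lborel ?A = (\<integral>\<^sup>+p. indicator ?A p \<partial>(lborel \<Otimes>\<^sub>M lborel))"
    by (simp add: lborel_prod)
  also have "\<dots> = (\<integral>\<^sup>+w. \<integral>\<^sup>+x. indicator ?A (x, w) \<partial>lborel \<partial>lborel)"
    by (rule lborel_pair.nn_integral_snd[symmetric]) (simp add: lborel_prod)
  also have "\<dots> = (\<integral>\<^sup>+w. \<integral>\<^sup>+x. indicator ?A (x, w) \<partial>lborel \<partial>(lborel \<Otimes>\<^sub>M lborel))"
    by (simp add: lborel_prod)
  also have "\<dots> = (\<integral>\<^sup>+z. \<integral>\<^sup>+y. \<integral>\<^sup>+x. indicator ?A (x, y, z) \<partial>lborel \<partial>lborel \<partial>lborel)"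
    by (rule lborel_pair.nn_integral_snd[symmetric]) (simp add: lborel_prod)
  also have "\<dots> = (\<integral>\<^sup>+z. indicator {0..1} z *
      ennreal (F * V * z powr (?d + 1) - I * z powr (r + ?d)) \<partial>lborel)"
  proof (rule nn_integral_cong)
    fix z :: real
    show "(\<integral>\<^sup>+y. \<integral>\<^sup>+x. indicator ?A (x, y, z) \<partial>lborel \<partial>lborel) = indicator {0..1} z *
      ennreal (F * V * z powr (?d + 1) - I * z powr (r + ?d))"
    proof (cases "0 < z \<and> z \<le> 1")
      case True
      then show ?thesis by (simp add: slice)
    next
      case False
      then have "indicator ?A (x, y, z) = (0::ennreal)" for x y
        by (auto simp: scaled_region_def)
      then show ?thesis using False r by (auto simp: indicator_def)
    qed
  qed
  also have "\<dots> = ennreal (F * V / (?d + 2) - I / (r + ?d + 1))"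
    using nn_integral_has_integral_lebesgue[OF nonneg int]
    by (simp add: ennreal_mult' ennreal_indicator)
  finally show ?thesis
    using has_integral_nonneg[OF int nonneg] by (simp add: measure_def)
qed

section \<open>The two relaxations as regions over a cone\<close>

lemma bounded_scaled_region:
  assumes "bounded Q" "\<And>x. x \<in> Q \<Longrightarrow> 0 \<le> g x" "F \<ge> 0"
  shows "bounded (scaled_region g Q F r)"
proof -
  obtain B where B: "\<And>x. x \<in> Q \<Longrightarrow> norm x \<le> B" using assms(1) by (auto simp: bounded_iff)
  have "scaled_region g Q F r \<subseteq> cball 0 B \<times> {0..F} \<times> {0..1}"
  proof
    fix p assume "p \<in> scaled_region g Q F r"
    then obtain x y z where p: "p = (x, y, z)" and z: "0 < z" "z \<le> 1" and w: "x /\<^sub>R z \<in> Q"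
      and y: "z powr r * g (x /\<^sub>R z) \<le> y" "y \<le> z * F"
      by (auto simp: scaled_region_def)
    have "norm x = z * norm (x /\<^sub>R z)" using z by simp
    also have "\<dots> \<le> 1 * B" using B[OF w] z by (intro mult_mono) auto
    finally have "norm x \<le> B" by simp
    moreover have "0 \<le> z powr r * g (x /\<^sub>R z)" using assms(2)[OF w] by simp
    moreover have "z * F \<le> F" using z assms(3) by (simp add: mult_left_le_one_le)
    ultimately show "p \<in> cball 0 B \<times> {0..F} \<times> {0..1}" using p y z by auto
  qed
  then show ?thesis by (rule bounded_subset[rotated]) (intro bounded_Times; simp)
qed

lemma convex_scaled_region:
  assumes "convex_on Q g"
  shows "convex (scaled_region g Q F 1)"
proof (rule convexI)
  fix p p' and u v :: real
  assume pp: "p \<in> scaled_region g Q F 1" "p' \<in> scaled_region g Q F 1"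
    and uv: "0 \<le> u" "0 \<le> v" "u + v = 1"
  obtain x y z where p: "p = (x, y, z)" and z: "0 < z" "z \<le> 1" and w: "x /\<^sub>R z \<in> Q"
    and y: "z * g (x /\<^sub>R z) \<le> y" "y \<le> z * F"
    using pp(1) by (auto simp: scaled_region_def)
  obtain x' y' z' where p': "p' = (x', y', z')" and z': "0 < z'" "z' \<le> 1" and w': "x' /\<^sub>R z' \<in> Q"
    and y': "z' * g (x' /\<^sub>R z') \<le> y'" "y' \<le> z' * F"
    using pp(2) by (auto simp: scaled_region_def)
  define Z where "Z = u * z + v * z'"
  have Z: "0 < Z" "Z \<le> 1"
  proof -
    show "0 < Z"
    proof (cases "u = 0")
      case False
      then show ?thesis using uv z z' by (auto simp: Z_def intro!: add_pos_nonneg)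
    qed (use uv z' in \<open>simp add: Z_def\<close>)
    show "Z \<le> 1" unfolding Z_def using convex_bound_le[OF z(2) z'(2) uv] .
  qed
  define s t where "s = u * z / Z" and "t = v * z' / Z"
  have st: "0 \<le> s" "0 \<le> t" "s + t = 1"
    using uv z z' Z by (auto simp: s_def t_def add_divide_distrib[symmetric] Z_def[symmetric])
  have comb: "(u *\<^sub>R x + v *\<^sub>R x') /\<^sub>R Z = s *\<^sub>R (x /\<^sub>R z) + t *\<^sub>R (x' /\<^sub>R z')"
    using z z' by (simp add: s_def t_def scaleR_add_right field_simps)
  have "convex Q" using assms by (rule convex_on_imp_convex)
  then have "(u *\<^sub>R x + v *\<^sub>R x') /\<^sub>R Z \<in> Q"
    unfolding comb using w w' st by (intro convexD)
  moreover have "Z * g ((u *\<^sub>R x + v *\<^sub>R x') /\<^sub>R Z) \<le> u * y + v * y'"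
  proof -
    have "g ((u *\<^sub>R x + v *\<^sub>R x') /\<^sub>R Z) \<le> s * g (x /\<^sub>R z) + t * g (x' /\<^sub>R z')"
      unfolding comb using assms w w' st unfolding convex_on_def by blast
    then have "Z * g ((u *\<^sub>R x + v *\<^sub>R x') /\<^sub>R Z) \<le> Z * (s * g (x /\<^sub>R z) + t * g (x' /\<^sub>R z'))"
      using Z by simp
    also have "\<dots> = u * (z * g (x /\<^sub>R z)) + v * (z' * g (x' /\<^sub>R z'))"
      using Z by (simp add: s_def t_def field_simps)
    also have "\<dots> \<le> u * y + v * y'"
      using y y' uv by (intro add_mono mult_left_mono)
    finally show ?thesis .
  qed
  moreover have "u * y + v * y' \<le> u * (z * F) + v * (z' * F)"
    using y y' uv by (intro add_mono mult_left_mono)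
  then have "u * y + v * y' \<le> Z * F" by (simp add: Z_def algebra_simps)
  ultimately show "u *\<^sub>R p + v *\<^sub>R p' \<in> scaled_region g Q F 1"
    using Z by (simp add: scaled_region_def p p' Z_def)
qed

lemma mem_scaleR_image_iff:
  fixes x :: "'a::real_vector"
  assumes "z \<noteq> 0"
  shows "x \<in> (\<lambda>w. z *\<^sub>R w) ` Q \<longleftrightarrow> x /\<^sub>R z \<in> Q"
proof
  assume "x /\<^sub>R z \<in> Q"
  then show "x \<in> (\<lambda>w. z *\<^sub>R w) ` Q" using assms by (intro image_eqI[of _ _ "x /\<^sub>R z"]) auto
qed (use assms in auto)

text \<open>
  The region is already convex, and passing to the closure only adds part of the frontier, which is
  a null set.
\<close>
lemma vol_perspective_relaxation:
  assumes "convex_on Q f" "bounded Q" "\<And>x. x \<in> Q \<Longrightarrow> 0 \<le> f x" "F \<ge> 0"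
  shows "vol (perspective_relaxation f Q (\<lambda>_. F)) = vol (scaled_region f Q F 1)"
proof -
  have "perspective_relaxation f Q (\<lambda>_. F) = closure (convex hull (scaled_region f Q F 1))"
    unfolding perspective_relaxation_def scaled_region_def
    by (intro arg_cong[where f = "\<lambda>S. closure (convex hull S)"])
       (auto simp: perspective_def mem_scaleR_image_iff)
  also have "convex hull (scaled_region f Q F 1) = scaled_region f Q F 1"
    using assms by (intro convex_hull_eq[THEN iffD2] convex_scaled_region)
  finally show ?thesis
    using measure_closure[OF bounded_scaled_region[OF assms(2,3,4)]
        negligible_convex_frontier[OF convex_scaled_region[OF assms(1)]]]
    by (simp only:)
qed

text \<open>
  The naive relaxation also admits \<open>z = 0\<close>, which contributes the origin only.
\<close>
lemma vol_naive_relaxation: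
  assumes "Q \<noteq> {}" "f 0 = 0" "scaled_region f Q F r \<in> sets borel"
    and hom: "\<And>x z. x \<in> Q \<Longrightarrow> 0 < z \<Longrightarrow> f (z *\<^sub>R x) = z powr r * f x"
  shows "vol (naive_relaxation f Q (\<lambda>_. F)) = vol (scaled_region f Q F r)"
proof -
  have hom': "f x = z powr r * f (x /\<^sub>R z)" if "0 < z" "x /\<^sub>R z \<in> Q" for x z
    using hom[OF that(2,1)] that by simp
  have "p \<in> naive_relaxation f Q (\<lambda>_. F) \<longleftrightarrow> p \<in> scaled_region f Q F r \<union> {0}" for p
  proof -
    obtain x y z where p: "p = (x, y, z)" by (cases p)
    consider "z < 0" | "z = 0" | "z > 0" by linarith
    then show ?thesis
    proof cases
      case 1
      then show ?thesis by (auto simp: p naive_relaxation_def scaled_region_def zero_prod_def)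
    next
      case 2
      then show ?thesis using assms(1,2)
        by (auto simp: p naive_relaxation_def scaled_region_def perspective_def zero_prod_def)
    next
      case 3
      then have "p \<in> naive_relaxation f Q (\<lambda>_. F) \<longleftrightarrow>
          x /\<^sub>R z \<in> Q \<and> f x \<le> y \<and> y \<le> z * F \<and> z \<le> 1"
        by (auto simp: p naive_relaxation_def perspective_def mem_scaleR_image_iff)
      also have "\<dots> \<longleftrightarrow> p \<in> scaled_region f Q F r \<union> {0}"
        using 3 hom'[of z x] by (auto simp: p scaled_region_def zero_prod_def)
      finally show ?thesis .
    qed
  qed
  then have "naive_relaxation f Q (\<lambda>_. F) = scaled_region f Q F r \<union> {0}" by blast
  moreover have "emeasure lborel (scaled_region f Q F r \<union> {0}) = emeasure lborel (scaled_region f Q F r)"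
    using assms(3) by (intro emeasure_Un_null_set) auto
  ultimately show ?thesis
    using assms(3) by (simp add: measure_def)
qed

section \<open>The power moment of the unit cube\<close>

text \<open>
  The integral of \<open>(k + c \<bullet> x)\<^sup>q\<close> over the unit cube for positive \<open>c\<close> and \<open>k\<close> (see
  \<open>nn_integral_cube_powr\<close>), given by its closed form, so that continuity in \<open>k\<close> up to \<open>k = 0\<close> is immediate.
\<close>
definition cube_moment :: "'a::euclidean_space \<Rightarrow> real \<Rightarrow> real \<Rightarrow> real" where
  "cube_moment c q k = mixed_diff (\<lambda>b. c \<bullet> b) (\<lambda>x. x powr (q + DIM('a))) Basis k /
     ((\<Prod>b\<in>Basis. c \<bullet> b) * pochhammer (q + 1) DIM('a))"

context
  fixes c :: "'a::euclidean_space" and q :: real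
  assumes c: "\<And>b. b \<in> Basis \<Longrightarrow> c \<bullet> b > 0" and q: "q \<ge> 1"
begin

lemma cube_moment_denominator_pos: "(\<Prod>b\<in>Basis. c \<bullet> b) * pochhammer (q + 1) DIM('a) > 0"
  using c q by (intro mult_pos_pos prod_pos pochhammer_pos) auto

lemma cube_moment_nonneg:
  assumes "k > 0" shows "0 \<le> cube_moment c q k"
proof -
  have "0 \<le> (\<Prod>b\<in>Basis. c \<bullet> b) * pochhammer (q + 1) DIM('a) * k powr q"
    using cube_moment_denominator_pos by simp
  also have "\<dots> \<le> mixed_diff (\<lambda>b. c \<bullet> b) (\<lambda>x. x powr (q + DIM('a))) Basis k"
    using mixed_diff_powr_ge[of "Basis :: 'a set" k q "\<lambda>b. c \<bullet> b"] assms q c by simp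
  finally show ?thesis
    using cube_moment_denominator_pos by (simp add: cube_moment_def)
qed

lemma inner_cube_bounds:
  assumes "x \<in> cbox 0 One" shows "0 \<le> c \<bullet> x" "c \<bullet> x \<le> c \<bullet> One"
proof -
  have "c \<bullet> x = (\<Sum>b\<in>Basis. (c \<bullet> b) * (x \<bullet> b))" by (rule euclidean_inner)
  moreover have "0 \<le> (\<Sum>b\<in>Basis. (c \<bullet> b) * (x \<bullet> b))"
    using assms c by (intro sum_nonneg mult_nonneg_nonneg) (auto simp: mem_box less_imp_le)
  moreover have "(\<Sum>b\<in>Basis. (c \<bullet> b) * (x \<bullet> b)) \<le> (\<Sum>b\<in>Basis. (c \<bullet> b) * 1)"
    using assms c by (intro sum_mono mult_left_mono) (auto simp: mem_box less_imp_le)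
  ultimately show "0 \<le> c \<bullet> x" "c \<bullet> x \<le> c \<bullet> One" by (simp_all add: inner_sum_right)
qed

lemma cube_moment_le:
  assumes "k > 0" shows "cube_moment c q k \<le> (k + c \<bullet> One) powr q"
proof -
  have "ennreal (cube_moment c q k) =
      (\<integral>\<^sup>+x. ennreal ((k + c \<bullet> x) powr q) * indicator (cbox 0 One) x \<partial>lborel)"
    unfolding cube_moment_def using assms q c by (intro nn_integral_cube_powr[symmetric]) auto
  also have "\<dots> \<le> (\<integral>\<^sup>+x. ennreal ((k + c \<bullet> One) powr q) * indicator (cbox 0 (One::'a)) x \<partial>lborel)"
    using inner_cube_bounds assms q
    by (intro nn_integral_mono) (auto split: split_indicator intro!: ennreal_leI powr_mono2)
  also have "\<dots> = ennreal ((k + c \<bullet> One) powr q)"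
    by (simp add: nn_integral_cmult_indicator emeasure_lborel_cbox_eq)
  finally show ?thesis by simp
qed

lemma tendsto_cube_moment:
  assumes "(h \<longlongrightarrow> 0) G" "\<forall>\<^sub>F u in G. h u \<ge> 0"
  shows "((\<lambda>u. cube_moment c q (h u)) \<longlongrightarrow> cube_moment c q 0) G"
proof -
  have "((\<lambda>u. (h u + sum (\<lambda>b. c \<bullet> b) T) powr (q + DIM('a))) \<longlongrightarrow>
      (0 + sum (\<lambda>b. c \<bullet> b) T) powr (q + DIM('a))) G" if "T \<in> Pow Basis" for T
  proof (rule tendsto_powr')
    have "sum (\<lambda>b. c \<bullet> b) T \<ge> 0" using that c by (intro sum_nonneg) (auto intro: less_imp_le)
    then have "\<forall>\<^sub>F u in G. 0 \<le> h u + sum (\<lambda>b. c \<bullet> b) T"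
      using assms(2) by (auto elim: eventually_mono)
    then show "0 + sum (\<lambda>b. c \<bullet> b) T \<noteq> 0 \<or>
        0 < q + DIM('a) \<and> (\<forall>\<^sub>F u in G. 0 \<le> h u + sum (\<lambda>b. c \<bullet> b) T)"
      using q by (auto intro: add_pos_pos)
  qed (intro tendsto_intros assms(1))+
  then show ?thesis
    unfolding cube_moment_def mixed_diff_def
    by (intro tendsto_divide tendsto_sum tendsto_mult tendsto_const
        cube_moment_denominator_pos[THEN less_imp_neq, symmetric]) auto
qed

text \<open>
  The steps \<open>c \<bullet> b\<close> have mean \<open>(c \<bullet> One) / d\<close>, so \<open>mixed_diff_powr_ge_sum\<close> at \<open>k = 0\<close> produces
  \<open>\<Sum>\<^sub>j j\<^sup>q / d\<^sup>q\<close>, and \<open>d!\<close> over the Pochhammer symbol is the quotient of Gamma values.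
\<close>
lemma cube_moment_0_ge:
  "cube_moment c q 0 \<ge> Gamma (q + 1) * fact DIM('a) / Gamma (q + real DIM('a) + 1) *
     ((\<Sum>j=1..DIM('a). real j powr q) / real DIM('a) powr q) * (c \<bullet> One) powr q"
proof -
  let ?d = "DIM('a)" and ?P = "\<Prod>b\<in>Basis. c \<bullet> b"
  have s: "c \<bullet> One \<ge> 0" using c by (simp add: inner_sum_right sum_nonneg less_imp_le)
  have P: "?P > 0" using c by (intro prod_pos) auto
  have "Gamma (q + 1) > 0" using q by (intro Gamma_real_pos) auto
  moreover have "q + 1 \<notin> \<int>\<^sub>\<le>\<^sub>0" using q by (auto elim!: nonpos_Ints_cases)
  ultimately have G: "fact ?d / pochhammer (q + 1) ?d = Gamma (q + 1) * fact ?d / Gamma (q + ?d + 1)"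
    by (simp add: pochhammer_Gamma add_ac)
  have "(\<Sum>j\<le>?d. (0 + j * ((c \<bullet> One) / ?d)) powr q) = (\<Sum>j\<le>?d. real j powr q * (c \<bullet> One) powr q / ?d powr q)"
    using s by (intro sum.cong) (auto simp: powr_divide powr_mult)
  also have "\<dots> = (\<Sum>j\<le>?d. real j powr q) / ?d powr q * (c \<bullet> One) powr q"
    by (simp add: sum_distrib_left sum_distrib_right sum_divide_distrib mult_ac)
  also have "(\<Sum>j\<le>?d. real j powr q) = (\<Sum>j=1..?d. real j powr q)"
    by (intro sum.mono_neutral_right) (auto simp: not_less_eq_eq)
  finally have sum_eq: "(\<Sum>j\<le>?d. (0 + j * ((c \<bullet> One) / ?d)) powr q) =
    (\<Sum>j=1..?d. real j powr q) / ?d powr q * (c \<bullet> One) powr q" .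
  have cancel: "x * p * y / (p * z) = x / z * y" if "p > 0" for x y z p :: real
    using that by simp
  have "fact ?d * ?P * (\<Sum>j\<le>?d. (0 + j * ((c \<bullet> One) / ?d)) powr q) \<le>
      mixed_diff (\<lambda>b. c \<bullet> b) (\<lambda>x. x powr (q + ?d)) Basis 0"
    using mixed_diff_powr_ge_sum[of "Basis :: 'a set" 0 q "\<lambda>b. c \<bullet> b"] c q
    by (simp add: inner_sum_right)
  then have "fact ?d * ?P * (\<Sum>j\<le>?d. (0 + j * ((c \<bullet> One) / ?d)) powr q) / (?P * pochhammer (q + 1) ?d)
      \<le> cube_moment c q 0"
    unfolding cube_moment_def using cube_moment_denominator_pos by (intro divide_right_mono) auto
  also have "fact ?d * ?P * (\<Sum>j\<le>?d. (0 + j * ((c \<bullet> One) / ?d)) powr q) / (?P * pochhammer (q + 1) ?d) =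
     fact ?d / pochhammer (q + 1) ?d * (\<Sum>j\<le>?d. (0 + j * ((c \<bullet> One) / ?d)) powr q)"
    by (rule cancel[OF P])
  finally show ?thesis unfolding sum_eq G by (simp add: mult_ac)
qed

end

section \<open>The relative gap for a shifted cube\<close>

lemma One_vec: "(One :: real ^ 'n) = 1"
proof -
  have "(One :: real ^ 'n) $ i = One \<bullet> axis i (1::real)" for i by (rule cart_eq_inner_axis)
  then show ?thesis by (simp add: vec_eq_iff)
qed

lemma inner_Basis_pos:
  fixes c :: "real ^ 'n"
  assumes "\<forall>i. c $ i > 0" "b \<in> Basis" shows "c \<bullet> b > 0"
  using assms by (auto simp: Basis_vec_def inner_axis)

lemma inner_pos:
  fixes c v :: "real ^ 'n"
  assumes "\<forall>i. c $ i > 0" "\<forall>i. v $ i > 0" shows "c \<bullet> v > 0"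
  using assms by (auto simp: inner_vec_def intro!: sum_pos)

lemma shifted_cube_mem:
  assumes "u > 0"
  shows "v0 + u *\<^sub>R x \<in> shifted_cube v0 u \<longleftrightarrow> x \<in> cbox 0 1"
  using assms by (auto simp: shifted_cube_def)

context
  fixes c v0 :: "real ^ 'n" and q u :: real
  assumes q: "q > 1" and c: "\<forall>i. c $ i > 0" and v0: "\<forall>i. v0 $ i > 0" and u: "u > 0"
begin

lemma inner_shifted_cube:
  assumes "x \<in> shifted_cube v0 u"
  shows "0 < c \<bullet> x" "c \<bullet> x \<le> c \<bullet> (v0 + u *\<^sub>R 1)"
proof -
  obtain w where x: "x = v0 + u *\<^sub>R w" and w: "w \<in> cbox 0 One"
    using assms by (auto simp: shifted_cube_def One_vec)
  have "0 \<le> c \<bullet> w" "c \<bullet> w \<le> c \<bullet> One"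
    using inner_cube_bounds[OF inner_Basis_pos[OF c] less_imp_le[OF q] w] by auto
  then show "0 < c \<bullet> x" "c \<bullet> x \<le> c \<bullet> (v0 + u *\<^sub>R 1)"
    using inner_pos[OF c v0] u by (auto simp: x inner_add_right One_vec intro!: add_pos_nonneg)
qed

lemma max_on_shifted_cube:
  shows "v0 + u *\<^sub>R 1 \<in> shifted_cube v0 u"
    and "x \<in> shifted_cube v0 u \<Longrightarrow> lin_power c q x \<le> lin_power c q (v0 + u *\<^sub>R 1)"
    and "max_on (lin_power c q) (shifted_cube v0 u) = lin_power c q (v0 + u *\<^sub>R 1)"
proof -
  show 1: "v0 + u *\<^sub>R 1 \<in> shifted_cube v0 u"
    using u by (auto simp: shifted_cube_mem mem_box_cart)
  show 2: "lin_power c q x \<le> lin_power c q (v0 + u *\<^sub>R 1)" if "x \<in> shifted_cube v0 u" for x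
    unfolding lin_power_def using q inner_shifted_cube[OF that] by (intro powr_mono2) auto
  show "max_on (lin_power c q) (shifted_cube v0 u) = lin_power c q (v0 + u *\<^sub>R 1)"
    unfolding max_on_def using 1 2 by (intro cSup_eq_maximum) auto
qed

lemma convex_shifted_cube: "convex (shifted_cube v0 u)"
  and compact_shifted_cube: "compact (shifted_cube v0 u)"
  unfolding shifted_cube_def
  using convex_affinity[of "cbox 0 1"] compact_affinity[of "cbox 0 1"] by auto

lemma convex_on_lin_power: "convex_on (shifted_cube v0 u) (lin_power c q)"
proof (intro convex_onI convex_shifted_cube)
  fix t :: real and x y
  assume t: "0 < t" "t < 1" and xy: "x \<in> shifted_cube v0 u" "y \<in> shifted_cube v0 u"
  show "lin_power c q ((1 - t) *\<^sub>R x + t *\<^sub>R y) \<le> (1 - t) * lin_power c q x + t * lin_power c q y"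
    using convex_onD[OF powr_convex[OF less_imp_le[OF q]], of t "c \<bullet> x" "c \<bullet> y"] t
      inner_shifted_cube(1)[OF xy(1)] inner_shifted_cube(1)[OF xy(2)]
    by (simp add: lin_power_def inner_add_right)
qed

lemma emeasure_shifted_cube: "emeasure lborel (shifted_cube v0 u) = ennreal (u ^ CARD('n))"
proof -
  have [measurable]: "shifted_cube v0 u \<in> sets borel"
    using compact_shifted_cube by (simp add: compact_imp_closed)
  have "emeasure lborel (shifted_cube v0 u) = (\<integral>\<^sup>+x. indicator (shifted_cube v0 u) x \<partial>lborel)"
    by simp
  also have "\<dots> = ennreal (u ^ CARD('n)) * (\<integral>\<^sup>+x. indicator (shifted_cube v0 u) (v0 + u *\<^sub>R x) \<partial>lborel)"
    using u by (subst nn_integral_lborel_affine[where c = u and t = v0]) auto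
  also have "(\<lambda>x. indicator (shifted_cube v0 u) (v0 + u *\<^sub>R x) :: ennreal) = indicator (cbox 0 One)"
    using u by (auto simp: shifted_cube_mem One_vec split: split_indicator)
  finally show ?thesis by (simp add: emeasure_lborel_cbox_eq)
qed

lemma nn_integral_shifted_cube:
  "(\<integral>\<^sup>+x. ennreal (lin_power c q x) * indicator (shifted_cube v0 u) x \<partial>lborel) =
     ennreal (u ^ CARD('n) * (u powr q * cube_moment c q ((c \<bullet> v0) / u)))"
proof -
  have [measurable]: "shifted_cube v0 u \<in> sets borel"
    using compact_shifted_cube by (simp add: compact_imp_closed)
  have [measurable]: "lin_power c q \<in> borel_measurable borel"
    unfolding lin_power_def by measurable
  have k: "(c \<bullet> v0) / u > 0" using inner_pos[OF c v0] u by simp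
  have "(\<integral>\<^sup>+x. ennreal (lin_power c q x) * indicator (shifted_cube v0 u) x \<partial>lborel) =
      ennreal (u ^ CARD('n)) * (\<integral>\<^sup>+x. ennreal (lin_power c q (v0 + u *\<^sub>R x)) *
        indicator (shifted_cube v0 u) (v0 + u *\<^sub>R x) \<partial>lborel)"
    using u by (subst nn_integral_lborel_affine[where c = u and t = v0]) auto
  also have "(\<integral>\<^sup>+x. ennreal (lin_power c q (v0 + u *\<^sub>R x)) *
        indicator (shifted_cube v0 u) (v0 + u *\<^sub>R x) \<partial>lborel) =
      (\<integral>\<^sup>+x. ennreal (u powr q) * (ennreal (((c \<bullet> v0) / u + c \<bullet> x) powr q) * indicator (cbox 0 One) x) \<partial>lborel)"
  proof (rule nn_integral_cong)
    fix x :: "real ^ 'n"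
    show "ennreal (lin_power c q (v0 + u *\<^sub>R x)) * indicator (shifted_cube v0 u) (v0 + u *\<^sub>R x) =
      ennreal (u powr q) * (ennreal (((c \<bullet> v0) / u + c \<bullet> x) powr q) * indicator (cbox 0 One) x)"
    proof (cases "x \<in> cbox 0 One")
      case True
      then have "0 \<le> c \<bullet> x"
        using inner_cube_bounds[OF inner_Basis_pos[OF c] less_imp_le[OF q]] by auto
      have "c \<bullet> (v0 + u *\<^sub>R x) = u * ((c \<bullet> v0) / u + c \<bullet> x)"
        using u by (simp add: inner_add_right field_simps)
      then have "lin_power c q (v0 + u *\<^sub>R x) = u powr q * ((c \<bullet> v0) / u + c \<bullet> x) powr q"
        using u k \<open>0 \<le> c \<bullet> x\<close> unfolding lin_power_def by (simp only:) (rule powr_mult)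
      then show ?thesis using True u by (simp add: shifted_cube_mem One_vec ennreal_mult')
    next
      case False
      then show ?thesis using u by (simp add: shifted_cube_mem One_vec)
    qed
  qed
  also have "\<dots> = ennreal (u powr q) * ennreal (cube_moment c q ((c \<bullet> v0) / u))"
    unfolding cube_moment_def using k q inner_Basis_pos[OF c]
    by (subst nn_integral_cmult) (simp_all add: nn_integral_cube_powr)
  finally show ?thesis
    using u cube_moment_nonneg[OF inner_Basis_pos[OF c] less_imp_le[OF q] k]
    by (simp add: ennreal_mult)
qed

text \<open>
  The relative gap depends only on the ratio \<open>R\<close> of the integral of \<open>f\<close> over the cube to the integral
  of the constant \<open>F\<close>. The scaling \<open>c \<bullet> (v\<^sub>0 + u x) = u (k + c \<bullet> x)\<close> moves the dependence on \<open>u\<close> into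
  \<open>k = (c \<bullet> v\<^sub>0) / u\<close>.
\<close>
lemma gap_ratio_shifted_cube:
  defines "d \<equiv> real CARD('n)"
    and "k \<equiv> (c \<bullet> v0) / u"
    and "F \<equiv> max_on (lin_power c q) (shifted_cube v0 u)"
  defines "R \<equiv> cube_moment c q k / (k + c \<bullet> 1) powr q"
  shows "relaxation_gap (lin_power c q) (shifted_cube v0 u) (\<lambda>_. F) /
           vol (naive_relaxation (lin_power c q) (shifted_cube v0 u) (\<lambda>_. F)) =
         (q - 1) * R / ((q + d + 1) - (d + 2) * R)"
    and "R \<le> 1"
proof -
  let ?Q = "shifted_cube v0 u" and ?f = "lin_power c q"
  let ?V = "u ^ CARD('n)"
  define I where "I = ?V * (u powr q * cube_moment c q k)"
  have k: "k > 0" using inner_pos[OF c v0] u by (simp add: k_def)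
  have s: "c \<bullet> 1 > 0" using c by (auto simp: inner_vec_def intro!: sum_pos)
  have "c \<bullet> (v0 + u *\<^sub>R 1) = u * (k + c \<bullet> 1)"
    using u by (simp add: k_def inner_add_right field_simps)
  then have F: "F = u powr q * (k + c \<bullet> 1) powr q"
    using u k s unfolding F_def max_on_shifted_cube(3) lin_power_def
    by (simp only:) (rule powr_mult)
  have FV: "F * ?V > 0" using F u k s by simp
  have IR: "I = F * ?V * R" using k s by (simp add: I_def F R_def)
  have [measurable]: "?Q \<in> sets borel"
    using compact_shifted_cube by (simp add: compact_imp_closed)
  have [measurable]: "?f \<in> borel_measurable borel"
    unfolding lin_power_def by measurable
  have I0: "0 \<le> I"
    using u cube_moment_nonneg[OF inner_Basis_pos[OF c] less_imp_le[OF q] k] by (simp add: I_def)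
  have region: "vol (scaled_region ?f ?Q F r) = F * ?V / (d + 2) - I / (r + d + 1)" if "r \<ge> 1" for r
  proof -
    have "vol (scaled_region ?f ?Q F r) =
        F * ?V / (DIM(real ^ 'n) + 2) - I / (r + DIM(real ^ 'n) + 1)"
      using that u FV I0 emeasure_shifted_cube nn_integral_shifted_cube
      by (intro measure_scaled_region) 
         (auto simp: I_def k_def F_def max_on_shifted_cube zero_less_mult_iff lin_power_def[of c q 0]
            max_on_shifted_cube(2)[unfolded lin_power_def] lin_power_def)
    then show ?thesis by (simp add: d_def)
  qed
  have "vol (perspective_relaxation ?f ?Q (\<lambda>_. F)) = vol (scaled_region ?f ?Q F 1)"
    using F compact_shifted_cube
    by (intro vol_perspective_relaxation convex_on_lin_power compact_imp_bounded)
       (auto simp: lin_power_def)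
  then have P: "vol (perspective_relaxation ?f ?Q (\<lambda>_. F)) = F * ?V / (d + 2) - I / (d + 2)"
    using region[of 1] by simp
  have "vol (naive_relaxation ?f ?Q (\<lambda>_. F)) = vol (scaled_region ?f ?Q F q)"
  proof (rule vol_naive_relaxation)
    show "?Q \<noteq> {}" using max_on_shifted_cube(1) by blast
    show "scaled_region ?f ?Q F q \<in> sets borel" by (rule scaled_region_borel) measurable
    show "?f (z *\<^sub>R x) = z powr q * ?f x" if "x \<in> ?Q" "0 < z" for x z
      using that inner_shifted_cube(1)[OF that(1)] by (simp add: lin_power_def powr_mult)
  qed (simp add: lin_power_def)
  then have P0: "vol (naive_relaxation ?f ?Q (\<lambda>_. F)) = F * ?V / (d + 2) - I / (q + d + 1)"
    using region[of q] q by simp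
  have "d \<ge> 0" by (simp add: d_def)
  show "R \<le> 1"
    using cube_moment_le[OF inner_Basis_pos[OF c] less_imp_le[OF q] k] k s
    by (simp add: R_def One_vec)
  have "F * ?V / (d + 2) - I / (q + d + 1) =
      F * ?V * ((q + d + 1) - (d + 2) * R) / ((d + 2) * (q + d + 1))"
    using \<open>d \<ge> 0\<close> q by (simp add: IR field_simps)
  moreover have "(F * ?V / (d + 2) - I / (q + d + 1)) - (F * ?V / (d + 2) - I / (d + 2)) =
      F * ?V * ((q - 1) * R) / ((d + 2) * (q + d + 1))"
  proof -
    have "I / (d + 2) - I / (q + d + 1) = I * (q - 1) / ((d + 2) * (q + d + 1))"
      using \<open>d \<ge> 0\<close> q by (subst diff_frac_eq) (auto simp: algebra_simps)
    then show ?thesis by (simp add: IR mult_ac)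
  qed
  moreover have cancel: "X * a / Y / (X * b / Y) = a / b" if "X > 0" "Y > 0" for X Y a b :: real
    using that by simp
  ultimately show "relaxation_gap ?f ?Q (\<lambda>_. F) / vol (naive_relaxation ?f ?Q (\<lambda>_. F)) =
      (q - 1) * R / ((q + d + 1) - (d + 2) * R)"
    unfolding relaxation_gap_def P P0 using FV \<open>d \<ge> 0\<close> q by (simp only:) (rule cancel; simp)
qed

end

section \<open>The limit for large cubes\<close>

theorem theorem4p5:
  fixes q :: real and c v0 :: "real ^ 'n"
    and f :: "real ^ 'n \<Rightarrow> real" and Q :: "real \<Rightarrow> (real ^ 'n) set"
    and F :: "real \<Rightarrow> real" and d :: nat
  defines "d \<equiv> CARD('n)"
    and "f \<equiv> lin_power c q"
    and "Q \<equiv> shifted_cube v0"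
    and "F \<equiv> (\<lambda>u. max_on f (Q u))"
  assumes "q > 1"
    and "\<forall>i. c $ i > 0"
    and "\<forall>i. v0 $ i > 0"
  shows "(\<forall>u>0. F u \<in> f ` Q u \<and> (\<forall>x\<in>Q u. f x \<le> F u) \<and>
                F u = f (v0 + u *\<^sub>R 1) \<and> F u = (u * (c \<bullet> 1) + c \<bullet> v0) powr q) \<and>
         (\<exists>L. ((\<lambda>u. relaxation_gap f (Q u) (\<lambda>_. F u) /
                    vol (naive_relaxation f (Q u) (\<lambda>_. F u))) \<longlongrightarrow> L) at_top \<and>
              L \<ge> ((q - 1) * (Gamma (q + 1) * fact d / Gamma (q + real d + 1)) *
                    ((\<Sum>j=1..d. real j powr q) / real d powr q)) /
                  ((q + real d + 1) -
                   (real d + 2) * (Gamma (q + 1) * fact d / Gamma (q + real d + 1)) *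
                    ((\<Sum>j=1..d. real j powr q) / real d powr q)))"
proof (intro conjI allI impI)
  fix u :: real assume u: "u > 0"
  note max = max_on_shifted_cube[OF assms(5-7) u]
  have F: "F u = f (v0 + u *\<^sub>R 1)" using max(3) by (simp add: F_def f_def Q_def)
  show "F u \<in> f ` Q u" unfolding F using max(1) by (simp add: Q_def)
  show "\<forall>x\<in>Q u. f x \<le> F u" unfolding F using max(2) by (simp add: Q_def f_def)
  show "F u = f (v0 + u *\<^sub>R 1)" by (rule F)
  show "F u = (u * (c \<bullet> 1) + c \<bullet> v0) powr q"
    unfolding F by (simp add: f_def lin_power_def inner_add_right add.commute)
next
  note q = assms(5) and c = assms(6) and v0 = assms(7)
  have c': "c \<bullet> b > 0" if "b \<in> Basis" for b by (rule inner_Basis_pos[OF c that])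
  have s: "c \<bullet> 1 > 0" using c by (auto simp: inner_vec_def intro!: sum_pos)
  define k where "k u = (c \<bullet> v0) / u" for u
  define R where "R u = cube_moment c q (k u) / (k u + c \<bullet> 1) powr q" for u
  define R0 where "R0 = cube_moment c q 0 / (0 + c \<bullet> 1) powr q"
  define B where "B = (Gamma (q + 1) * fact d / Gamma (q + real d + 1)) *
                    ((\<Sum>j=1..d. real j powr q) / real d powr q)"
  have k0: "(k \<longlongrightarrow> 0) at_top"
    unfolding k_def by (rule tendsto_divide_0[OF tendsto_const
        filterlim_mono[OF filterlim_ident at_top_le_at_infinity order_refl]])
  have ev: "\<forall>\<^sub>F u in at_top. u > (0::real)" by (rule eventually_gt_at_top)
  have "\<forall>\<^sub>F u in at_top. k u \<ge> 0"
    using ev by eventually_elim (simp add: k_def inner_pos[OF c v0] less_imp_le)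
  then have R_lim: "(R \<longlongrightarrow> R0) at_top"
    unfolding R_def R0_def using k0 s c' q
    by (intro tendsto_intros tendsto_cube_moment) auto
  have "R0 \<le> 1"
  proof (rule tendsto_upperbound[OF R_lim])
    show "\<forall>\<^sub>F u in at_top. R u \<le> 1"
      using ev by eventually_elim (simp add: R_def k_def gap_ratio_shifted_cube(2)[OF q c v0])
  qed simp
  then have "(real d + 2) * R0 \<le> real d + 2" by (intro mult_left_le) auto
  then have den: "(q + real d + 1) - (real d + 2) * R0 > 0"
    using q by argo
  let ?L = "(q - 1) * R0 / ((q + real d + 1) - (real d + 2) * R0)"
  have "((\<lambda>u. (q - 1) * R u / ((q + real d + 1) - (real d + 2) * R u)) \<longlongrightarrow> ?L) at_top"
    using den by (intro tendsto_intros R_lim) auto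
  moreover have "\<forall>\<^sub>F u in at_top. (q - 1) * R u / ((q + real d + 1) - (real d + 2) * R u) =
      relaxation_gap f (Q u) (\<lambda>_. F u) / vol (naive_relaxation f (Q u) (\<lambda>_. F u))"
    using ev by eventually_elim
      (simp add: R_def k_def d_def F_def f_def Q_def gap_ratio_shifted_cube(1)[OF q c v0])
  ultimately have lim: "((\<lambda>u. relaxation_gap f (Q u) (\<lambda>_. F u) /
      vol (naive_relaxation f (Q u) (\<lambda>_. F u))) \<longlongrightarrow> ?L) at_top"
    by (rule Lim_transform_eventually)
  have "B * (c \<bullet> 1) powr q \<le> cube_moment c q 0"
    using cube_moment_0_ge[OF c' less_imp_le[OF q]] by (simp add: B_def d_def One_vec)
  then have B_le: "B \<le> R0" using s by (simp add: R0_def field_simps)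
  have "B \<ge> 0"
    unfolding B_def using q
    by (intro mult_nonneg_nonneg divide_nonneg_nonneg sum_nonneg)
       (auto intro!: Gamma_real_nonneg)
  then have "(q - 1) * B / ((q + real d + 1) - (real d + 2) * B) \<le> ?L"
    using B_le den q \<open>R0 \<le> 1\<close>
    by (intro frac_le mult_left_mono diff_left_mono mult_nonneg_nonneg) auto
  then show "\<exists>L. ((\<lambda>u. relaxation_gap f (Q u) (\<lambda>_. F u) /
                    vol (naive_relaxation f (Q u) (\<lambda>_. F u))) \<longlongrightarrow> L) at_top \<and>
              L \<ge> ((q - 1) * (Gamma (q + 1) * fact d / Gamma (q + real d + 1)) *
                    ((\<Sum>j=1..d. real j powr q) / real d powr q)) /
                  ((q + real d + 1) -
                   (real d + 2) * (Gamma (q + 1) * fact d / Gamma (q + real d + 1)) *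
                    ((\<Sum>j=1..d. real j powr q) / real d powr q))"
    using lim by (intro exI[of _ ?L]) (simp add: B_def mult.assoc)
qed

end
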